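(* Let $\mathcal{X}$ be a separable Banach space, let $\{m_n\}$ be an increasing sequence of positive integers, and let $(\{x_n\},\{h_{n,i}\}_{n\in\mathbb{N},\,1\le i\le m_n})$ be an approximative atomic decomposition for $\mathcal{X}$ with respect to a BK-space $\mathcal{X}_d$, with bounds $A$ and $B$. Let $K\in L(\mathcal{X})$, $K\neq 0$, have closed range, and let $K^*$ be its adjoint on $\mathcal{X}^*$. Then $(\{x_n\},\{K^*h_{n,i}\}_{n\in\mathbb{N},\,1\le i\le m_n})$ is an approximative $K$-atomic decomposition for $\mathcal{X}$ with respect to $\mathcal{X}_d$ with bounds $A$ and $B\|K\|$.
   Context: Scalars are $\mathbb{R}$ or $\mathbb{C}$. $L(\mathcal{X})$ is the space of bounded linear operators on $\mathcal{X}$, and $\mathcal{X}^*$ is the dual space. Given an increasing sequence $\{m_n\}_{n\in\mathbb{N}}$ of positive integers, a BK-space $\mathcal{X}_d$ here is a Banach space whose elements are scalar families $\{c_{n,i}\}_{n\in\mathbb{N},\,1\le i\le m_n}$ (with coordinatewise linear operations) and on which every coordinate functional is continuous. Definition. Let $K\in L(\mathcal{X})$, $\{x_n\}\subset\mathcal{X}$, and $\{h_{n,i}\}_{n\in\mathbb{N},\,1\le i\le m_n}\subset\mathcal{X}^*$. The pair $(\{x_n\},\{h_{n,i}\})$ is an approximative $K$-atomic decomposition for $\mathcal{X}$ with respect to $\mathcal{X}_d$ if: (a) $\{h_{n,i}(x)\}_{n\in\mathbb{N},1\le i\le m_n}\in\mathcal{X}_d$ for all $x\in\mathcal{X}$;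 (b) there exist constants $A$ and $B$ with $0<A\le B<\infty$ such that $A\|K(x)\|_{\mathcal{X}}\le \|\{h_{n,i}(x)\}\|_{\mathcal{X}_d}\le B\|x\|_{\mathcal{X}}$ for all $x\in\mathcal{X}$; (c) for all $x\in\mathcal{X}$ the limit $\lim_{n\to\infty}\sum_{i=1}^{m_n}h_{n,i}(x)x_i$ exists in $\mathcal{X}$ and equals $K(x)$. The constants $A$ and $B$ in (b) are called lower and upper bounds of the approximative $K$-atomic decomposition. An approximative atomic decomposition is an approximative $K$-atomic decomposition with $K=I_{\mathcal{X}}$, the identity operator.
   Formalization: "With bounds A and B‖K‖" means that both are positive and satisfy the lower and upper inequalities; A ≤ B‖K‖ is not claimed, since it fails e.g. for X = ℝ, A = B = 1, K = I/2; some ordered pair of bounds is still shown to exist. *)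

theory Defs
  imports "HOL-Analysis.Analysis" "HOL-Library.Function_Algebras"
begin

text \<open>
  The scalar field is a type \<open>'k\<close> of class \<open>real_normed_field\<close>: by the
  Gelfand--Mazur theorem such a field is isometrically isomorphic to \<open>real\<close> or to
  \<open>complex\<close>, so quantifying over \<open>'k\<close> is the same as allowing both real and complex
  scalars.  Since the library has no class of complex Banach spaces, a Banach space over \<open>'k\<close>
  is a type of class \<open>banach\<close> with a \<open>'k\<close>-scalar multiplication that extends
  \<open>scaleR\<close> and for which the norm is homogeneous.
\<close>

locale banach_space_over = vector_space smul
  for smul :: "'k::real_normed_field \<Rightarrow> 'a::banach \<Rightarrow> 'a" +
  assumes norm_smul: "norm (smul a x) = norm a * norm x"
    and smul_of_real: "smul (of_real r) x = r *\<^sub>R x"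

text \<open>
  The type of bounded operators of the library only knows real linearity; \<open>'k\<close>-linearity is added
  here.  The operator norm does not depend on the scalar field.
\<close>

definition bounded_operators :: "('k::real_normed_field \<Rightarrow> 'a::banach \<Rightarrow> 'a) \<Rightarrow> ('a \<Rightarrow>\<^sub>L 'a) set"
  where "bounded_operators smul = {T. Vector_Spaces.linear smul smul (blinfun_apply T)}"

definition dual_space :: "('k::real_normed_field \<Rightarrow> 'a::banach \<Rightarrow> 'a) \<Rightarrow> ('a \<Rightarrow>\<^sub>L 'k) set"
  where "dual_space smul = {f. Vector_Spaces.linear smul (*) (blinfun_apply f)}"

definition dual_adjoint :: "('a::banach \<Rightarrow>\<^sub>L 'a) \<Rightarrow> ('a \<Rightarrow>\<^sub>L 'k) \<Rightarrow> ('a \<Rightarrow>\<^sub>L 'k::real_normed_field)"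
  where "dual_adjoint T f = f o\<^sub>L T"

definition family_index :: "(nat \<Rightarrow> nat) \<Rightarrow> (nat \<times> nat) set"
  where "family_index m = {(n, i). 1 \<le> i \<and> i \<le> m n}"

text \<open>
  A scalar family indexed by \<open>family_index m\<close> is encoded as a function on all of
  \<open>nat \<times> nat\<close> that vanishes outside the index set.  The norm is only meaningful on the
  carrier \<open>Xd\<close>, so the induced distance is cut off outside of it.
\<close>

locale normed_family_space =
  fixes m :: "nat \<Rightarrow> nat"
    and Xd :: "(nat \<times> nat \<Rightarrow> 'k::real_normed_field) set"
    and nrm :: "(nat \<times> nat \<Rightarrow> 'k) \<Rightarrow> real"
  assumes vanishes: "\<lbrakk>c \<in> Xd; p \<notin> family_index m\<rbrakk> \<Longrightarrow> c p = 0"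
    and subspace: "module.subspace (\<lambda>a c p. a * c p) Xd"
    and nrm_nonneg: "c \<in> Xd \<Longrightarrow> 0 \<le> nrm c"
    and nrm_eq_0: "c \<in> Xd \<Longrightarrow> nrm c = 0 \<longleftrightarrow> c = 0"
    and nrm_triangle: "\<lbrakk>c \<in> Xd; d \<in> Xd\<rbrakk> \<Longrightarrow> nrm (c + d) \<le> nrm c + nrm d"
    and nrm_scale: "c \<in> Xd \<Longrightarrow> nrm (\<lambda>p. a * c p) = norm a * nrm c"
begin

definition nrm_dist :: "(nat \<times> nat \<Rightarrow> 'k) \<Rightarrow> (nat \<times> nat \<Rightarrow> 'k) \<Rightarrow> real"
  where "nrm_dist c d = (if c \<in> Xd \<and> d \<in> Xd then nrm (c - d) else 0)"

lemma module_families: "module (\<lambda>a (c :: nat \<times> nat \<Rightarrow> 'k) p. a * c p)"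
  by unfold_locales (auto simp: fun_eq_iff algebra_simps)

lemma diff_in_Xd: "\<lbrakk>c \<in> Xd; d \<in> Xd\<rbrakk> \<Longrightarrow> c - d \<in> Xd"
  using module.subspace_diff[OF module_families subspace] by blast

sublocale Metric_space Xd nrm_dist
proof
  fix c d e :: "nat \<times> nat \<Rightarrow> 'k"
  show "0 \<le> nrm_dist c d"
    by (simp add: nrm_dist_def nrm_nonneg diff_in_Xd)
  show "nrm_dist c d = nrm_dist d c"
  proof (cases "c \<in> Xd \<and> d \<in> Xd")
    case True
    have "(\<lambda>p. (- 1) * (c - d) p) = d - c"
      by (auto simp: fun_eq_iff)
    then show ?thesis
      using True nrm_scale[of "c - d" "- 1"] by (simp add: nrm_dist_def diff_in_Xd)
  qed (auto simp: nrm_dist_def)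
  assume cd: "c \<in> Xd" "d \<in> Xd"
  then show "nrm_dist c d = 0 \<longleftrightarrow> c = d"
    by (simp add: nrm_dist_def nrm_eq_0 diff_in_Xd)
  assume "e \<in> Xd"
  then show "nrm_dist c e \<le> nrm_dist c d + nrm_dist d e"
    using cd nrm_triangle[of "c - d" "d - e"] by (simp add: nrm_dist_def diff_in_Xd)
qed

end

locale bk_space = normed_family_space m Xd nrm
  for m :: "nat \<Rightarrow> nat"
    and Xd :: "(nat \<times> nat \<Rightarrow> 'k::real_normed_field) set"
    and nrm :: "(nat \<times> nat \<Rightarrow> 'k) \<Rightarrow> real" +
  assumes complete: mcomplete
    and coordinate_continuous:
      "p \<in> family_index m \<Longrightarrow> continuous_map mtopology euclidean (\<lambda>c. c p)"

definition coefficient_family ::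
  "(nat \<Rightarrow> nat) \<Rightarrow> (nat \<Rightarrow> nat \<Rightarrow> 'a::banach \<Rightarrow>\<^sub>L 'k::real_normed_field) \<Rightarrow> 'a \<Rightarrow> (nat \<times> nat \<Rightarrow> 'k)"
  where "coefficient_family m h y = (\<lambda>(n, i). if (n, i) \<in> family_index m then h n i y else 0)"

text \<open>
  The sequence \<open>x\<close> is indexed from 1, so \<open>x 0\<close> plays no role, nor do the functionals \<open>h n i\<close> with
  \<open>(n, i)\<close> outside the index set.
\<close>

definition approximative_K_atomic_decomposition ::
  "('k::real_normed_field \<Rightarrow> 'a::banach \<Rightarrow> 'a) \<Rightarrow> ('a \<Rightarrow>\<^sub>L 'a) \<Rightarrow> (nat \<Rightarrow> nat) \<Rightarrow>
    (nat \<times> nat \<Rightarrow> 'k) set \<Rightarrow> ((nat \<times> nat \<Rightarrow> 'k) \<Rightarrow> real) \<Rightarrow>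
    (nat \<Rightarrow> 'a) \<Rightarrow> (nat \<Rightarrow> nat \<Rightarrow> 'a \<Rightarrow>\<^sub>L 'k) \<Rightarrow> bool"
  where "approximative_K_atomic_decomposition smul K m Xd nrm x h \<longleftrightarrow>
    K \<in> bounded_operators smul \<and>
    (\<forall>(n, i) \<in> family_index m. h n i \<in> dual_space smul) \<and>
    (\<forall>y. coefficient_family m h y \<in> Xd) \<and>
    (\<exists>A B. 0 < A \<and> A \<le> B \<and>
      (\<forall>y. A * norm (K y) \<le> nrm (coefficient_family m h y) \<and>
           nrm (coefficient_family m h y) \<le> B * norm y)) \<and>
    (\<forall>y. (\<lambda>n. \<Sum>i = 1..m n. smul (h n i y) (x i)) \<longlonglongrightarrow> K y)"

abbreviation approximative_atomic_decomposition ::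
  "('k::real_normed_field \<Rightarrow> 'a::banach \<Rightarrow> 'a) \<Rightarrow> (nat \<Rightarrow> nat) \<Rightarrow>
    (nat \<times> nat \<Rightarrow> 'k) set \<Rightarrow> ((nat \<times> nat \<Rightarrow> 'k) \<Rightarrow> real) \<Rightarrow>
    (nat \<Rightarrow> 'a) \<Rightarrow> (nat \<Rightarrow> nat \<Rightarrow> 'a \<Rightarrow>\<^sub>L 'k) \<Rightarrow> bool"
  where "approximative_atomic_decomposition smul \<equiv>
    approximative_K_atomic_decomposition smul id_blinfun"

text \<open>
  To have bounds \<open>A\<close> and \<open>B\<close> means that \<open>A > 0\<close> and \<open>B > 0\<close> satisfy the lower and the upper
  inequality.  The relation \<open>A \<le> B\<close> is deliberately not part of it: every decomposition admits some
  ordered pair of bounds, but a lower bound for a \<open>K\<close>-decomposition can exceed an upper one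
  when \<open>norm K < 1\<close>.  For \<open>K = id_blinfun\<close> on a nonzero space, \<open>A \<le> B\<close> is automatic.
\<close>

definition has_bounds ::
  "('a::banach \<Rightarrow>\<^sub>L 'a) \<Rightarrow> (nat \<Rightarrow> nat) \<Rightarrow> ((nat \<times> nat \<Rightarrow> 'k::real_normed_field) \<Rightarrow> real) \<Rightarrow>
    (nat \<Rightarrow> nat \<Rightarrow> 'a \<Rightarrow>\<^sub>L 'k) \<Rightarrow> real \<Rightarrow> real \<Rightarrow> bool"
  where "has_bounds K m nrm h A B \<longleftrightarrow>
    0 < A \<and> 0 < B \<and>
    (\<forall>y. A * norm (K y) \<le> nrm (coefficient_family m h y) \<and>
         nrm (coefficient_family m h y) \<le> B * norm y)"

end

theory Submission
  imports Defs
begin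

text \<open>
  The \<open>K\<close>-decomposition is the decomposition of the identity read at the point \<open>K y\<close>: since
  \<open>(K\<^sup>* h) y = h (K y)\<close>, the coefficients of \<open>y\<close> for the functionals \<open>K\<^sup>* h\<close> are the
  coefficients of \<open>K y\<close> for the functionals \<open>h\<close> (\<open>coefficient_family_dual_adjoint\<close>).  Membership
  in \<open>X\<^sub>d\<close>, the lower inequality and the convergence of the partial sums to \<open>K y\<close> are thus
  instances of the hypotheses, and \<open>norm (K y) \<le> norm K * norm y\<close> turns the upper inequality for
  \<open>K y\<close> into one for \<open>y\<close>.
\<close>

lemma dual_adjoint_apply: "dual_adjoint T f y = f (T y)"
  by (simp add: dual_adjoint_def)

lemma dual_adjoint_in_dual_space:
  assumes "T \<in> bounded_operators smul" and "f \<in> dual_space smul"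
  shows "dual_adjoint T f \<in> dual_space smul"
proof -
  have "Vector_Spaces.linear smul (*) (blinfun_apply f \<circ> blinfun_apply T)"
    using assms unfolding bounded_operators_def dual_space_def
    by (auto intro: Vector_Spaces.linear_compose)
  moreover have "blinfun_apply (dual_adjoint T f) = blinfun_apply f \<circ> blinfun_apply T"
    by (simp add: fun_eq_iff dual_adjoint_apply)
  ultimately show ?thesis
    by (simp add: dual_space_def)
qed

lemma coefficient_family_dual_adjoint:
  "coefficient_family m (\<lambda>n i. dual_adjoint T (h n i)) y = coefficient_family m h (T y)"
  by (auto simp: coefficient_family_def dual_adjoint_apply fun_eq_iff)

text \<open>
  \<open>K \<noteq> 0\<close> keeps the new upper bound \<open>B * norm K\<close> positive.
\<close>

lemma has_bounds_dual_adjoint: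
  assumes bounds: "has_bounds id_blinfun m nrm h A B" and "K \<noteq> 0"
  shows "has_bounds K m nrm (\<lambda>n i. dual_adjoint K (h n i)) A (B * norm K)"
proof -
  have pos: "0 < A" "0 < B"
    and lower: "A * norm y \<le> nrm (coefficient_family m h y)"
    and upper: "nrm (coefficient_family m h y) \<le> B * norm y" for y
    using bounds by (simp_all add: has_bounds_def)
  have "nrm (coefficient_family m h (K y)) \<le> B * norm K * norm y" for y
  proof -
    have "nrm (coefficient_family m h (K y)) \<le> B * norm (K y)"
      by (rule upper)
    also have "\<dots> \<le> B * (norm K * norm y)"
      using pos by (intro mult_left_mono norm_blinfun) simp
    finally show ?thesis
      by (simp add: mult.assoc)
  qed
  with pos lower \<open>K \<noteq> 0\<close> show ?thesis
    by (simp add: has_bounds_def coefficient_family_dual_adjoint)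
qed

theorem theorem2p7:
  fixes smul :: "'k::real_normed_field \<Rightarrow> 'a::banach \<Rightarrow> 'a"
    and K :: "'a \<Rightarrow>\<^sub>L 'a"
    and m :: "nat \<Rightarrow> nat"
    and Xd :: "(nat \<times> nat \<Rightarrow> 'k) set"
    and nrm :: "(nat \<times> nat \<Rightarrow> 'k) \<Rightarrow> real"
    and x :: "nat \<Rightarrow> 'a"
    and h :: "nat \<Rightarrow> nat \<Rightarrow> 'a \<Rightarrow>\<^sub>L 'k"
    and A B :: real
  assumes "banach_space_over smul"
    and "separable_space (euclidean :: 'a topology)"
    and "incseq m" and "\<And>n. 0 < m n"
    and "bk_space m Xd nrm"
    and "approximative_atomic_decomposition smul m Xd nrm x h"
    and "has_bounds id_blinfun m nrm h A B"
    and "K \<in> bounded_operators smul" and "K \<noteq> 0"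
    and "closed (range (blinfun_apply K))"
  shows "approximative_K_atomic_decomposition smul K m Xd nrm x (\<lambda>n i. dual_adjoint K (h n i))
    \<and> has_bounds K m nrm (\<lambda>n i. dual_adjoint K (h n i)) A (B * norm K)"
proof -
  let ?g = "\<lambda>n i. dual_adjoint K (h n i)"
  have dual: "h n i \<in> dual_space smul" if "(n, i) \<in> family_index m" for n i
    using assms(6) that by (auto simp: approximative_K_atomic_decomposition_def)
  have mem: "coefficient_family m h y \<in> Xd" for y
    using assms(6) by (simp add: approximative_K_atomic_decomposition_def)
  have lim: "(\<lambda>n. \<Sum>i = 1..m n. smul (h n i y) (x i)) \<longlonglongrightarrow> y" for y
    using assms(6) by (simp add: approximative_K_atomic_decomposition_def)
  have bounds: "has_bounds K m nrm ?g A (B * norm K)"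
    using assms(7,9) by (rule has_bounds_dual_adjoint)
  \<comment> \<open>\<open>B * norm K\<close> may be smaller than \<open>A\<close> when \<open>norm K < 1\<close>; enlarging it to the maximum gives
    the ordered pair of bounds that the definition of a decomposition asks for.\<close>
  have ordered: "\<exists>A' B'. 0 < A' \<and> A' \<le> B' \<and>
      (\<forall>y. A' * norm (K y) \<le> nrm (coefficient_family m ?g y) \<and>
           nrm (coefficient_family m ?g y) \<le> B' * norm y)"
  proof (intro exI conjI allI)
    show "0 < A" "A \<le> max A (B * norm K)"
      using bounds by (simp_all add: has_bounds_def)
    fix y
    show "A * norm (K y) \<le> nrm (coefficient_family m ?g y)"
      using bounds by (simp add: has_bounds_def)
    have "nrm (coefficient_family m ?g y) \<le> B * norm K * norm y"
      using bounds by (simp add: has_bounds_def)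
    also have "\<dots> \<le> max A (B * norm K) * norm y"
      by (intro mult_right_mono) simp_all
    finally show "nrm (coefficient_family m ?g y) \<le> max A (B * norm K) * norm y" .
  qed
  have "approximative_K_atomic_decomposition smul K m Xd nrm x ?g"
    unfolding approximative_K_atomic_decomposition_def
    using assms(8) dual mem lim ordered
    by (auto simp: dual_adjoint_in_dual_space coefficient_family_dual_adjoint dual_adjoint_apply)
  then show ?thesis
    using bounds ..
qed

end
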